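(* Let $X$ be any compact, $0$-dimensional, extremally disconnected space of weight at most $\mathfrak{c}$. Then there is a non-reversible filter $\mathcal{F}$ on $\omega$ such that $K_{\mathcal{F}}$ is homeomorphic to $X$.
   Context: Spaces are Hausdorff. $\mathfrak{c}=2^{\aleph_0}$. A space is extremally disconnected if the closure of every open subset is open. A space is $0$-dimensional if it has a base of clopen sets. A filter on $\omega$ is a nonempty family of subsets of $\omega$ closed under supersets and finite intersections; all filters on $\omega$ are assumed to contain the Fréchet filter of all cofinite subsets of $\omega$. For a filter $\mathcal{F}$ on $\omega$, $\xi(\mathcal{F})$ is the topological space with underlying set $\omega\cup\{\mathcal{F}\}$ in which every point of $\omega$ is isolated and the neighborhoods of the point $\mathcal{F}$ are the sets $\{\mathcal{F}\}\cup A$ with $A\in\mathcal{F}$. A topological space is reversible if every continuous bijection of the space onto itself is a homeomorphism. A filter $\mathcal{F}$ is reversible if the space $\xi(\mathcal{F})$ is reversible, and non-reversible otherwise. $\beta\omega$ is the Stone space of all ultrafilters on $\omega$, $\omega^*=\beta\omega\setminus\omega$ is the subspace of free ultrafilters, and $K_{\mathcal{F}}=\{p\in\beta\omega:\mathcal{F}\subset p\}$, a closed subset of $\omega^*$, considered with the subspace topology.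
   Formalization: The space X is additionally assumed to be infinite; for every finite X (including the empty one) the claim fails, since any filter F with K_F finite is reversible (e.g. a free ultrafilter when X is a point). *)

theory Defs
  imports "HOL-Analysis.Analysis"
begin

section \<open>Classes of topological spaces\<close>

definition is_base :: "'a topology \<Rightarrow> 'a set set \<Rightarrow> bool" where
  "is_base X \<B> \<longleftrightarrow> (\<forall>V\<in>\<B>. openin X V) \<and>
     (\<forall>U x. openin X U \<and> x \<in> U \<longrightarrow> (\<exists>V\<in>\<B>. x \<in> V \<and> V \<subseteq> U))"

definition zero_dimensional_space :: "'a topology \<Rightarrow> bool" where
  "zero_dimensional_space X \<longleftrightarrow> (\<exists>\<B>. is_base X \<B> \<and> (\<forall>V\<in>\<B>. closedin X V))"

definition extremally_disconnected_space :: "'a topology \<Rightarrow> bool" where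
  "extremally_disconnected_space X \<longleftrightarrow> (\<forall>U. openin X U \<longrightarrow> openin X (X closure_of U))"

text \<open>The cardinal \<open>\<cc> = 2\<^sup>\<aleph>\<^sup>0\<close> is represented by the power set of \<open>nat\<close>.\<close>

definition weight_le_continuum :: "'a topology \<Rightarrow> bool" where
  "weight_le_continuum X \<longleftrightarrow> (\<exists>\<B>. is_base X \<B> \<and> \<B> \<lesssim> (UNIV :: nat set set))"

definition reversible_space :: "'a topology \<Rightarrow> bool" where
  "reversible_space X \<longleftrightarrow>
     (\<forall>f. continuous_map X X f \<and> bij_betw f (topspace X) (topspace X)
          \<longrightarrow> homeomorphic_map X X f)"

section \<open>Filters on the natural numbers\<close>

text \<open>
  A filter on \<open>\<omega>\<close> is an element \<open>F\<close> of the type \<open>nat filter\<close>, and a set \<open>A\<close> belongs to it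
  when \<open>eventually (\<lambda>n. n \<in> A) F\<close>. The improper filter, which contains the empty set, is
  \<open>bot\<close>. The order of this type is reverse inclusion: \<open>p \<le> F\<close> says that every member of \<open>F\<close>
  is a member of \<open>p\<close>, so the filters that contain the Frechet filter are those with
  \<open>F \<le> cofinite\<close>.
\<close>

definition filter_space :: "nat filter \<Rightarrow> nat option topology" where \<comment> \<open>the space \<open>\<xi>(F)\<close>;
    \<open>Some n\<close> is the point \<open>n\<close> of \<open>\<omega>\<close> and \<open>None\<close> is the point \<open>F\<close>\<close>
  "filter_space F =
     topology (\<lambda>U. None \<in> U \<longrightarrow> eventually (\<lambda>n. n \<in> {k. Some k \<in> U}) F)"

lemma openin_filter_space:
  "openin (filter_space F) U \<longleftrightarrow>
     (None \<in> U \<longrightarrow> eventually (\<lambda>n. n \<in> {k. Some k \<in> U}) F)"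
proof -
  have "istopology (\<lambda>U. None \<in> U \<longrightarrow> eventually (\<lambda>n. n \<in> {k. Some k \<in> U}) F)"
    unfolding istopology_def
  proof (intro conjI allI impI)
    fix S T :: "nat option set"
    assume "None \<in> S \<longrightarrow> eventually (\<lambda>n. n \<in> {k. Some k \<in> S}) F"
      and "None \<in> T \<longrightarrow> eventually (\<lambda>n. n \<in> {k. Some k \<in> T}) F"
      and "None \<in> S \<inter> T"
    then show "eventually (\<lambda>n. n \<in> {k. Some k \<in> S \<inter> T}) F"
      by (simp add: eventually_conj_iff)
  next
    fix \<K> :: "nat option set set"
    assume *: "\<forall>K\<in>\<K>. None \<in> K \<longrightarrow> eventually (\<lambda>n. n \<in> {k. Some k \<in> K}) F"
      and "None \<in> \<Union>\<K>"
    then obtain K where "K \<in> \<K>" "None \<in> K"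
      by blast
    with * have "eventually (\<lambda>n. n \<in> {k. Some k \<in> K}) F"
      by blast
    then show "eventually (\<lambda>n. n \<in> {k. Some k \<in> \<Union>\<K>}) F"
      by (rule eventually_mono) (use \<open>K \<in> \<K>\<close> in blast)
  qed
  then show ?thesis
    by (simp add: filter_space_def)
qed

lemma topspace_filter_space [simp]: "topspace (filter_space F) = UNIV"
proof -
  have "openin (filter_space F) UNIV"
    by (simp add: openin_filter_space)
  then show ?thesis
    using openin_subset by blast
qed

lemma open_singleton_filter_space: "openin (filter_space F) {Some n}"
  by (simp add: openin_filter_space)

lemma neighbourhood_None_filter_space:
  "(\<exists>U. openin (filter_space F) U \<and> None \<in> U \<and> U \<subseteq> N) \<longleftrightarrow>
     (\<exists>A. eventually (\<lambda>n. n \<in> A) F \<and> N = insert None (Some ` A))"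
proof
  assume "\<exists>U. openin (filter_space F) U \<and> None \<in> U \<and> U \<subseteq> N"
  then obtain U where U: "eventually (\<lambda>n. n \<in> {k. Some k \<in> U}) F" "None \<in> U" "U \<subseteq> N"
    by (auto simp: openin_filter_space)
  have "eventually (\<lambda>n. n \<in> {k. Some k \<in> N}) F"
    using U(1) by (rule eventually_mono) (use U(3) in auto)
  moreover have "N = insert None (Some ` {k. Some k \<in> N})"
  proof (rule set_eqI)
    fix x show "x \<in> N \<longleftrightarrow> x \<in> insert None (Some ` {k. Some k \<in> N})"
      using U by (cases x) auto
  qed
  ultimately show "\<exists>A. eventually (\<lambda>n. n \<in> A) F \<and> N = insert None (Some ` A)"
    by blast
next
  assume "\<exists>A. eventually (\<lambda>n. n \<in> A) F \<and> N = insert None (Some ` A)"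
  then have "openin (filter_space F) N" "None \<in> N"
    by (auto simp: openin_filter_space image_iff)
  then show "\<exists>U. openin (filter_space F) U \<and> None \<in> U \<and> U \<subseteq> N"
    by blast
qed

definition reversible_filter :: "nat filter \<Rightarrow> bool" where
  "reversible_filter F \<longleftrightarrow> reversible_space (filter_space F)"

section \<open>The Stone space of ultrafilters\<close>

definition ultrafilter :: "nat filter \<Rightarrow> bool" where \<comment> \<open>a maximal proper filter\<close>
  "ultrafilter p \<longleftrightarrow> p \<noteq> bot \<and> (\<forall>q. q \<noteq> bot \<and> q \<le> p \<longrightarrow> q = p)"

text \<open>The points of \<open>\<beta>\<omega>\<close> are all ultrafilters, since \<open>A = UNIV\<close> gives the whole space.\<close>

definition beta_omega :: "nat filter topology" where
  "beta_omega =
     topology_generated_by (range (\<lambda>A. {p. ultrafilter p \<and> eventually (\<lambda>n. n \<in> A) p}))"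

lemma topspace_beta_omega: "topspace beta_omega = {p. ultrafilter p}"
proof -
  have "{p. ultrafilter p} = {p. ultrafilter p \<and> eventually (\<lambda>n. n \<in> UNIV) p}"
    by simp
  then show ?thesis
    unfolding beta_omega_def topology_generated_by_topspace by blast
qed

text \<open>
  If \<open>F \<le> cofinite\<close>, every \<open>p\<close> in \<open>K_set F\<close> is free, so the subspace topologies induced on
  \<open>K_set F\<close> by \<open>\<beta>\<omega>\<close> and by \<open>\<omega>\<^sup>*\<close> are the same.
\<close>

definition K_set :: "nat filter \<Rightarrow> nat filter set" where
  "K_set F = {p \<in> topspace beta_omega. p \<le> F}"

definition K_space :: "nat filter \<Rightarrow> nat filter topology" where
  "K_space F = subtopology beta_omega (K_set F)"

text \<open>
  A filter with finite \<open>K_set F\<close> is always reversible: a continuous bijection of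
  \<open>filter_space F\<close> fixes \<open>None\<close> (if \<open>F\<close> is proper) and induces an injection of \<open>K_set F\<close>
  into itself, which is onto by finiteness. So a space that is homeomorphic to \<open>K_space F\<close>
  for some non-reversible \<open>F\<close> has to be infinite.
\<close>

end

theory Submission
  imports Defs
begin

text \<open>
  The proof embeds \<open>X\<close> into \<open>\<omega>\<^sup>*\<close> by some map \<open>e\<close> and then moves the copy so that a permutation
  of \<open>\<omega>\<close> maps it onto a proper part of itself.

  \<^emph>\<open>The embedding.\<close> The weight bound gives a family of clopen sets \<open>E t\<close>, \<open>t \<subseteq> \<omega>\<close>, that separates
  the points of \<open>X\<close>. Against an independent family \<open>I t\<close> of subsets of \<open>\<omega>\<close>, each point \<open>x\<close> defines
  the free filter generated by the sets \<open>I t\<close> with \<open>x \<in> E t\<close> and the complements of the others. Each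
  set of naturals belongs to these filters for an open set of points. By Zorn's lemma these filters
  can be enlarged, keeping this openness, to a maximal family; extremal disconnectedness makes the
  members of a maximal family ultrafilters (\<open>minimal_lower_semicontinuous_ultra\<close>), and openness then
  is continuity. This is Sikorski's extension theorem in the language of filters.

  \<^emph>\<open>Moving the copy.\<close> As \<open>X\<close> is infinite, there are points \<open>z n\<close> of \<open>X\<close> such that the ultrafilters
  \<open>u n = e (z n)\<close> have pairwise disjoint members \<open>D n\<close>. Given ultrafilters \<open>q n\<close> with pairwise disjoint
  members \<open>B n\<close>, the closure of \<open>{q n}\<close> is a copy of \<open>\<beta>\<omega>\<close>, so for every permutation \<open>g\<close> the map
  \<open>s x = g (e x-lim q)\<close> is another embedding of \<open>X\<close>. The inverse of \<open>g\<close> maps \<open>s x\<close> into the closure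
  of \<open>{q n}\<close>. Hence the image of \<open>s\<close> is mapped into itself as soon as every \<open>q n\<close> lies in it, and for
  this it suffices that \<open>q n = s (z n)\<close>, that is,

    \<open>q n = g (u n-lim q)\<close> for all \<open>n\<close>.

  It is mapped onto a proper part, because \<open>q 0\<close> is isolated in the closure of \<open>{q n}\<close> and is not a
  limit of \<open>q\<close> along a free ultrafilter. The intersection of the ultrafilters \<open>s x\<close> is then the
  wanted filter.

  The fixed-point equation is solved in \<open>self_reproducing_ultrafilters\<close>. It is solvable if \<open>g\<close>
  carries \<open>B m\<close> into \<open>B n\<close> for all \<open>m \<in> D n\<close> and no point of \<open>B n\<close> ever returns to \<open>B n\<close>; such a
  permutation comes from a tree structure on \<open>\<omega>\<close> (\<open>branching_permutation\<close>). The solution is a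
  maximal family of filters with \<open>g (u n-lim q) \<le> q n\<close>, and again maximality yields ultrafilters.
\<close>

section \<open>Ultrafilters, limits of filters, and maximal families of filters\<close>

lemma ultrafilter_iff:
  "ultrafilter p \<longleftrightarrow> p \<noteq> bot \<and> (\<forall>P. eventually P p \<or> eventually (\<lambda>n. \<not> P n) p)"
proof (intro iffI conjI allI)
  fix P
  assume u: "ultrafilter p"
  show "eventually P p \<or> eventually (\<lambda>n. \<not> P n) p"
  proof (rule disjCI)
    assume "\<not> eventually (\<lambda>n. \<not> P n) p"
    then have "inf p (principal {n. P n}) \<noteq> bot"
      by (simp add: trivial_limit_def eventually_inf_principal)
    with u have "inf p (principal {n. P n}) = p"
      by (simp add: ultrafilter_def)
    moreover have "eventually P (inf p (principal {n. P n}))"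
      by (simp add: eventually_inf_principal)
    ultimately show "eventually P p"
      by simp
  qed
next
  assume *: "p \<noteq> bot \<and> (\<forall>P. eventually P p \<or> eventually (\<lambda>n. \<not> P n) p)"
  have "p \<le> q" if "q \<noteq> bot" "q \<le> p" for q
  proof (rule filter_leI)
    fix P assume P: "eventually P q"
    show "eventually P p"
    proof (rule ccontr)
      assume "\<not> eventually P p"
      then have "eventually (\<lambda>n. \<not> P n) q"
        using * filter_leD[OF that(2)] by blast
      with P have "eventually (\<lambda>n. False) q"
        by eventually_elim simp
      with that(1) show False
        by (simp add: trivial_limit_def)
    qed
  qed
  with * show "ultrafilter p"
    by (auto simp: ultrafilter_def intro: order.antisym)
qed (simp add: ultrafilter_def)

lemma ultrafilter_eventually_not:
  assumes "ultrafilter p"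
  shows "eventually (\<lambda>n. \<not> P n) p \<longleftrightarrow> \<not> eventually P p"
proof
  assume "eventually (\<lambda>n. \<not> P n) p"
  then have "eventually (\<lambda>n. False) p" if "eventually P p"
    using that by eventually_elim simp
  with assms show "\<not> eventually P p"
    by (auto simp: ultrafilter_iff trivial_limit_def)
qed (use assms in \<open>auto simp: ultrafilter_iff\<close>)

lemma ultrafilter_neq_bot: "ultrafilter p \<Longrightarrow> p \<noteq> bot"
  by (simp add: ultrafilter_def)

lemma ultrafilters_separated:
  assumes "ultrafilter p" "ultrafilter q" "p \<noteq> q"
  obtains P where "eventually P p" "\<not> eventually P q"
proof -
  have "\<not> q \<le> p"
    using assms unfolding ultrafilter_def by metis
  then show ?thesis
    using that by (auto simp: le_filter_def)
qed

lemma ultrafilter_filtermap: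
  assumes "ultrafilter p"
  shows "ultrafilter (filtermap g p)"
  using assms by (simp add: ultrafilter_iff eventually_filtermap filtermap_bot_iff)

text \<open>For ultrafilters this is the limit of \<open>Q\<close> along \<open>u\<close> in the compact space \<open>\<beta>\<omega>\<close>.\<close>

definition filter_lim :: "'i filter \<Rightarrow> ('i \<Rightarrow> 'b filter) \<Rightarrow> 'b filter" where
  "filter_lim u Q = Abs_filter (\<lambda>P. eventually (\<lambda>m. eventually P (Q m)) u)"

lemma eventually_filter_lim:
  "eventually P (filter_lim u Q) \<longleftrightarrow> eventually (\<lambda>m. eventually P (Q m)) u"
  unfolding filter_lim_def
proof (rule eventually_Abs_filter, rule is_filter.intro)
  fix P R
  assume "\<forall>x. P x \<longrightarrow> R x" "eventually (\<lambda>m. eventually P (Q m)) u"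
  then show "eventually (\<lambda>m. eventually R (Q m)) u"
    by (metis (mono_tags, lifting) eventually_mono)
qed (auto simp: eventually_conj_iff)

lemma ultrafilter_filter_lim:
  assumes "ultrafilter u" "\<And>m. ultrafilter (Q m)"
  shows "ultrafilter (filter_lim u Q)"
  using assms(1)
  by (simp add: ultrafilter_iff eventually_filter_lim trivial_limit_def
      ultrafilter_eventually_not[OF assms(2)] ultrafilter_neq_bot[OF assms(2), unfolded trivial_limit_def])

lemma eventually_INF_chain:
  fixes C :: "('i \<Rightarrow> 'b filter) set"
  assumes "C \<noteq> {}" and "\<And>d e. d \<in> C \<Longrightarrow> e \<in> C \<Longrightarrow> d \<le> e \<or> e \<le> d"
  shows "eventually P (INF e\<in>C. e i) \<longleftrightarrow> (\<exists>e\<in>C. eventually P (e i))"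
proof (rule eventually_INF_base[OF assms(1)])
  fix d e assume "d \<in> C" "e \<in> C"
  with assms(2)[OF this] show "\<exists>x\<in>C. x i \<le> inf (d i) (e i)"
    by (metis le_funD inf.absorb1 inf.absorb2 order_refl)
qed

text \<open>
  The order of filters is reverse inclusion, so a minimal family consists of filters that are as
  large as possible. Along a chain the infimum is the union of the filters
  (\<open>eventually_INF_chain\<close>), hence conditions on single members survive it.
\<close>

lemma filter_family_Zorn:
  fixes \<P> :: "('i \<Rightarrow> 'b filter) set"
  assumes ne: "e0 \<in> \<P>"
    and chain: "\<And>C. C \<subseteq> \<P> \<Longrightarrow> C \<noteq> {} \<Longrightarrow> (\<And>d e. d \<in> C \<Longrightarrow> e \<in> C \<Longrightarrow> d \<le> e \<or> e \<le> d)
      \<Longrightarrow> (\<lambda>i. INF e\<in>C. e i) \<in> \<P>"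
  obtains m where "m \<in> \<P>" "\<And>e. e \<in> \<P> \<Longrightarrow> e \<le> m \<Longrightarrow> e = m"
proof -
  have "\<exists>m\<in>\<P>. \<forall>e\<in>\<P>. e \<le> m \<longrightarrow> e = m"
  proof (rule predicate_Zorn)
    show "partial_order_on \<P> (relation_of (\<lambda>a b. b \<le> a) \<P>)"
      by (rule partial_order_on_relation_ofI) auto
  next
    fix C assume C: "C \<in> Chains (relation_of (\<lambda>a b. b \<le> a) \<P>)"
    show "\<exists>u\<in>\<P>. \<forall>a\<in>C. u \<le> a"
    proof (cases "C = {}")
      case True
      with ne show ?thesis by auto
    next
      case False
      have "(\<lambda>i. INF e\<in>C. e i) \<in> \<P>"
      proof (rule chain[OF _ False])
        show "C \<subseteq> \<P>"
          by (rule Chains_relation_of[OF C])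
        show "d \<le> e \<or> e \<le> d" if "d \<in> C" "e \<in> C" for d e
          using C that by (auto simp: Chains_def relation_of_def)
      qed
      moreover have "(\<lambda>i. INF e\<in>C. e i) \<le> a" if "a \<in> C" for a
        using that by (auto simp: le_fun_def intro: INF_lower)
      ultimately show ?thesis by blast
    qed
  qed
  then show ?thesis using that by blast
qed

section \<open>Embedding an extremally disconnected compact space into the free ultrafilters\<close>

text \<open>
  Hausdorff's independent family, with a number \<open>k\<close> read as a pair of a number \<open>n\<close> and a finite
  set of subsets of \<open>{..<n}\<close>: the set \<open>I t\<close> consists of the pairs whose second component contains
  the trace of \<open>t\<close> on \<open>{..<n}\<close>. Finitely many sets \<open>t\<close> have different traces for all large \<open>n\<close>, and
  then the traces of \<open>a\<close> alone can be selected.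
\<close>

lemma independent_family_nat:
  obtains I :: "nat set \<Rightarrow> nat set" where
    "\<And>a b. finite a \<Longrightarrow> finite b \<Longrightarrow> a \<inter> b = {} \<Longrightarrow>
      infinite ((\<Inter>t\<in>a. I t) \<inter> (\<Inter>t\<in>b. - I t))"
proof
  define tr where "tr n t = set_encode (t \<inter> {..<n})" for n and t :: "nat set"
  define I where "I t = {k. tr (fst (prod_decode k)) t \<in> set_decode (snd (prod_decode k))}" for t
  fix a b :: "nat set set"
  assume fin: "finite a" "finite b" and disj: "a \<inter> b = {}"
  define d where "d s t = (LEAST k. k \<in> s \<longleftrightarrow> k \<notin> t)" for s t :: "nat set"
  have d: "d s t \<in> s \<longleftrightarrow> d s t \<notin> t" if "s \<noteq> t" for s t
    unfolding d_def by (rule LeastI_ex) (use that in auto)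
  define N where "N = Suc (Max (insert 0 (case_prod d ` (a \<times> b))))"
  have less_N: "d s t < N" if "s \<in> a" "t \<in> b" for s t
  proof -
    have "d s t \<le> Max (insert 0 (case_prod d ` (a \<times> b)))"
      using that fin by (intro Max_ge) auto
    then show ?thesis by (simp add: N_def)
  qed
  define c where "c n = prod_encode (n, set_encode (tr n ` a))" for n
  have "c n \<in> (\<Inter>t\<in>a. I t) \<inter> (\<Inter>t\<in>b. - I t)" if n: "N \<le> n" for n
  proof -
    have "tr n s \<noteq> tr n t" if "s \<in> a" "t \<in> b" for s t
    proof
      assume "tr n s = tr n t"
      then have "s \<inter> {..<n} = t \<inter> {..<n}"
        by (simp add: tr_def set_encode_eq)
      moreover have "d s t \<in> {..<n}"
        using less_N[OF that] n by simp
      moreover have "s \<noteq> t"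
        using that disj by auto
      ultimately show False
        using d by blast
    qed
    then have "tr n t \<notin> tr n ` a" if "t \<in> b" for t
      using that by (metis imageE)
    then show ?thesis
      using fin by (simp add: c_def I_def)
  qed
  then have "c ` {N..} \<subseteq> (\<Inter>t\<in>a. I t) \<inter> (\<Inter>t\<in>b. - I t)"
    by auto
  moreover have "infinite (c ` {N..})"
  proof -
    have "inj_on c {N..}"
      by (auto simp: inj_on_def c_def prod_encode_eq)
    then show ?thesis
      by (simp add: finite_image_iff infinite_Ici)
  qed
  ultimately show "infinite ((\<Inter>t\<in>a. I t) \<inter> (\<Inter>t\<in>b. - I t))"
    by (rule infinite_super)
qed

text \<open>
  The sets of a base of size at most \<open>\<cc>\<close> need not be clopen. But it is enough to choose a clopen set
  between any two nested base sets that admit one, and the pairs of base sets can be coded by sets of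
  naturals, through the even and the odd elements.
\<close>

lemma clopen_separating_family:
  assumes "Hausdorff_space X" "zero_dimensional_space X" "weight_le_continuum X"
  obtains E :: "nat set \<Rightarrow> 'a set" where
    "\<And>t. openin X (E t)" "\<And>t. closedin X (E t)"
    "\<And>x y. x \<in> topspace X \<Longrightarrow> y \<in> topspace X \<Longrightarrow> x \<noteq> y \<Longrightarrow> \<exists>t. x \<in> E t \<and> y \<notin> E t"
proof -
  obtain \<B> where base: "is_base X \<B>" and "\<B> \<lesssim> (UNIV :: nat set set)"
    using assms(3) by (auto simp: weight_le_continuum_def)
  then obtain i :: "'a set \<Rightarrow> nat set" where i: "inj_on i \<B>"
    by (auto simp: lepoll_def)
  obtain \<C> where base': "is_base X \<C>" and clo: "\<And>V. V \<in> \<C> \<Longrightarrow> closedin X V"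
    using assms(2) by (auto simp: zero_dimensional_space_def)
  define v where "v t = inv_into \<B> i {k. 2 * k \<in> t}" for t
  define w where "w t = inv_into \<B> i {k. 2 * k + 1 \<in> t}" for t
  define good where "good t C \<longleftrightarrow> openin X C \<and> closedin X C \<and> v t \<subseteq> C \<and> C \<subseteq> w t" for t C
  define E where "E t = (if \<exists>C. good t C then SOME C. good t C else {})" for t
  have good_E: "good t (E t)" if "good t C" for t C
    using that someI[of "good t" C] by (auto simp: E_def)
  have clopen: "openin X (E t)" "closedin X (E t)" for t
  proof -
    have "openin X (E t) \<and> closedin X (E t)"
    proof (cases "\<exists>C. good t C")
      case True
      then show ?thesis using good_E good_def by metis
    next
      case False
      then show ?thesis by (simp add: E_def)
    qed
    then show "openin X (E t)" "closedin X (E t)" by auto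
  qed
  have sep: "\<exists>t. x \<in> E t \<and> y \<notin> E t" if xy: "x \<in> topspace X" "y \<in> topspace X" "x \<noteq> y" for x y
  proof -
    obtain U V where "openin X U" "openin X V" "x \<in> U" "y \<in> V" "disjnt U V"
      using assms(1) xy unfolding Hausdorff_space_def by meson
    then have U: "openin X U" "x \<in> U" "y \<notin> U"
      by (auto simp: disjnt_iff)
    obtain W where W: "W \<in> \<B>" "x \<in> W" "W \<subseteq> U"
      using base U unfolding is_base_def by meson
    then have "openin X W"
      using base by (auto simp: is_base_def)
    then obtain C where C: "C \<in> \<C>" "x \<in> C" "C \<subseteq> W"
      using base' W(2) unfolding is_base_def by meson
    then have C': "openin X C" "closedin X C"
      using base' clo by (auto simp: is_base_def)
    then obtain V where V: "V \<in> \<B>" "x \<in> V" "V \<subseteq> C"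
      using base C(2) unfolding is_base_def by meson
    define t where "t = (\<lambda>k. 2 * k) ` i V \<union> (\<lambda>k. 2 * k + 1) ` i W"
    have parity: "2 * k \<noteq> Suc (2 * j)" "Suc (2 * k) \<noteq> 2 * j" for k j :: nat
      by presburger+
    have "{k. 2 * k \<in> t} = i V" "{k. 2 * k + 1 \<in> t} = i W"
      using parity by (auto simp: t_def)
    then have "v t = V" "w t = W"
      using V W i by (auto simp: v_def w_def)
    then have "good t (E t)"
      using good_E[of t C] C C' V by (simp add: good_def)
    then show ?thesis
      using \<open>v t = V\<close> \<open>w t = W\<close> V W U unfolding good_def by blast
  qed
  show ?thesis
    by (rule that[OF clopen sep])
qed

text \<open>
  In terms of the closed sets \<open>K (e x)\<close> of ultrafilters, this says that \<open>x \<mapsto> K (e x)\<close> is an upper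
  semicontinuous map with nonempty compact values. If all \<open>e x\<close> are ultrafilters, it says that \<open>e\<close> is a
  continuous map into \<open>\<beta>\<omega>\<close>.
\<close>

definition lower_semicontinuous_filters :: "'a topology \<Rightarrow> ('a \<Rightarrow> nat filter) \<Rightarrow> bool" where
  "lower_semicontinuous_filters X e \<longleftrightarrow>
     (\<forall>x\<in>topspace X. e x \<noteq> bot) \<and> (\<forall>P. openin X {x \<in> topspace X. eventually P (e x)})"

text \<open>
  Where \<open>e x\<close> does not decide \<open>P\<close>, one could add \<open>P\<close> or its negation to \<open>e x\<close>; the difficulty is to
  choose for all \<open>x\<close> so that openness is preserved. The set of points where \<open>e x\<close> contains \<open>P\<close> is open
  and disjoint from the open set where it contains the negation, so its closure \<open>U\<close> is disjoint from
  the latter as well. By extremal disconnectedness \<open>U\<close> is clopen: add \<open>P\<close> on \<open>U\<close> and its negation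
  elsewhere.
\<close>

lemma minimal_lower_semicontinuous_ultra:
  assumes ed: "extremally_disconnected_space X"
    and e: "lower_semicontinuous_filters X e"
    and minimal: "\<And>d. lower_semicontinuous_filters X d \<Longrightarrow> d \<le> e \<Longrightarrow> d = e"
    and x: "x \<in> topspace X"
  shows "ultrafilter (e x)"
proof -
  have op: "openin X {x \<in> topspace X. eventually P (e x)}" for P
    using e by (simp add: lower_semicontinuous_filters_def)
  have nb: "y \<in> topspace X \<Longrightarrow> e y \<noteq> bot" for y
    using e by (simp add: lower_semicontinuous_filters_def)
  have "eventually P (e x) \<or> eventually (\<lambda>n. \<not> P n) (e x)" for P
  proof -
    define U where "U = X closure_of {x \<in> topspace X. eventually P (e x)}"
    have U: "openin X U" "closedin X U"
      using ed op by (auto simp: U_def extremally_disconnected_space_def)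
    have Usub: "y \<in> U" if "y \<in> topspace X" "eventually P (e y)" for y
      using that closure_of_subset[of "{x \<in> topspace X. eventually P (e x)}" X]
      by (auto simp: U_def)
    define d where "d y = inf (e y) (principal {n. P n \<longleftrightarrow> y \<in> U})" for y
    have d_iff: "eventually R (d y) \<longleftrightarrow> eventually (\<lambda>n. (P n \<longleftrightarrow> y \<in> U) \<longrightarrow> R n) (e y)" for R y
      by (simp add: d_def eventually_inf_principal)
    have "lower_semicontinuous_filters X d"
      unfolding lower_semicontinuous_filters_def
    proof (intro conjI ballI allI)
      fix y assume y: "y \<in> topspace X"
      have "\<not> eventually (\<lambda>n. \<not> (P n \<longleftrightarrow> y \<in> U)) (e y)"
      proof (cases "y \<in> U")
        case True
        have "\<not> eventually (\<lambda>n. \<not> P n) (e y)"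
        proof
          assume "eventually (\<lambda>n. \<not> P n) (e y)"
          then have "y \<in> {x \<in> topspace X. eventually (\<lambda>n. \<not> P n) (e x)}"
            using y by simp
          moreover have meets: "\<exists>z. z \<in> {x \<in> topspace X. eventually P (e x)} \<and> z \<in> V"
            if "y \<in> V" "openin X V" for V
            using True that unfolding U_def in_closure_of by simp
          ultimately have "\<exists>z. z \<in> {x \<in> topspace X. eventually P (e x)} \<and>
              z \<in> {x \<in> topspace X. eventually (\<lambda>n. \<not> P n) (e x)}"
            by (intro meets op)
          then obtain z where z: "z \<in> topspace X" "eventually P (e z)"
              "eventually (\<lambda>n. \<not> P n) (e z)"
            by auto
          from z(2,3) have "eventually (\<lambda>n. False) (e z)"
            by eventually_elim simp
          with nb[OF z(1)] show False by (simp add: trivial_limit_def)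
        qed
        with True show ?thesis by simp
      next
        case False
        with Usub y show ?thesis by auto
      qed
      then show "d y \<noteq> bot"
        by (simp add: trivial_limit_def d_iff)
    next
      fix R
      have "eventually R (d x) \<longleftrightarrow> (if x \<in> U then eventually (\<lambda>n. P n \<longrightarrow> R n) (e x)
          else eventually (\<lambda>n. \<not> P n \<longrightarrow> R n) (e x))" for x
        by (simp add: d_iff)
      then have "{x \<in> topspace X. eventually R (d x)} =
        (U \<inter> {x \<in> topspace X. eventually (\<lambda>n. P n \<longrightarrow> R n) (e x)}) \<union>
        ((topspace X - U) \<inter> {x \<in> topspace X. eventually (\<lambda>n. \<not> P n \<longrightarrow> R n) (e x)})"
        by auto
      also have "openin X \<dots>"
        using U op by (intro openin_Un openin_Int) (auto simp: openin_diff)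
      finally show "openin X {x \<in> topspace X. eventually R (d x)}" .
    qed
    moreover have "d \<le> e"
      by (simp add: d_def le_fun_def)
    ultimately have "d = e"
      by (rule minimal)
    moreover have "eventually (\<lambda>n. P n \<longleftrightarrow> x \<in> U) (d x)"
      by (simp add: d_iff)
    ultimately show ?thesis
      by (cases "x \<in> U") auto
  qed
  with nb[OF x] show ?thesis
    by (simp add: ultrafilter_iff)
qed

lemma extend_to_ultrafilters:
  assumes ed: "extremally_disconnected_space X"
    and e0: "lower_semicontinuous_filters X e0"
  obtains e where "e \<le> e0" "lower_semicontinuous_filters X e"
    "\<And>x. x \<in> topspace X \<Longrightarrow> ultrafilter (e x)"
proof -
  define \<P> where "\<P> = {e. e \<le> e0 \<and> lower_semicontinuous_filters X e}"
  have "e0 \<in> \<P>"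
    using e0 by (simp add: \<P>_def)
  have closed: "(\<lambda>x. INF e\<in>C. e x) \<in> \<P>"
    if C: "C \<subseteq> \<P>" "C \<noteq> {}"
      and chain: "\<And>d e. d \<in> C \<Longrightarrow> e \<in> C \<Longrightarrow> d \<le> e \<or> e \<le> d" for C
  proof -
    have ev: "eventually P (INF e\<in>C. e x) \<longleftrightarrow> (\<exists>e\<in>C. eventually P (e x))" for P x
      by (rule eventually_INF_chain[OF C(2) chain])
    obtain d where "d \<in> C" using C by auto
    then have "(\<lambda>x. INF e\<in>C. e x) \<le> d" "d \<le> e0"
      using C by (auto simp: le_fun_def \<P>_def intro: INF_lower)
    then have "(\<lambda>x. INF e\<in>C. e x) \<le> e0"
      by (rule order_trans)
    moreover have "lower_semicontinuous_filters X (\<lambda>x. INF e\<in>C. e x)"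
      unfolding lower_semicontinuous_filters_def
    proof (intro conjI ballI allI)
      show "(INF e\<in>C. e x) \<noteq> bot" if "x \<in> topspace X" for x
        using C(1) that ev[of "\<lambda>_. False" x]
        by (auto simp: trivial_limit_def \<P>_def lower_semicontinuous_filters_def)
      fix P
      have "{x \<in> topspace X. eventually P (INF e\<in>C. e x)} =
          (\<Union>e\<in>C. {x \<in> topspace X. eventually P (e x)})"
        by (auto simp: ev)
      also have "openin X \<dots>"
        using C(1) by (intro openin_Union) (auto simp: \<P>_def lower_semicontinuous_filters_def)
      finally show "openin X {x \<in> topspace X. eventually P (INF e\<in>C. e x)}" .
    qed
    ultimately show ?thesis
      by (simp add: \<P>_def)
  qed
  obtain e where e: "e \<in> \<P>" "\<And>d. d \<in> \<P> \<Longrightarrow> d \<le> e \<Longrightarrow> d = e"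
    using filter_family_Zorn[OF \<open>e0 \<in> \<P>\<close> closed] by blast
  have "d = e" if "lower_semicontinuous_filters X d" "d \<le> e" for d
    using that e by (auto simp: \<P>_def intro: order_trans)
  then have "ultrafilter (e x)" if "x \<in> topspace X" for x
    using e(1) that by (intro minimal_lower_semicontinuous_ultra[OF ed]) (auto simp: \<P>_def)
  with e(1) show ?thesis
    using that by (auto simp: \<P>_def)
qed

text \<open>
  A single \<open>J t x\<close> depends on \<open>x\<close> only through membership in the clopen set \<open>E t\<close>, and each member of
  \<open>e0 x\<close> depends on finitely many \<open>J t x\<close>, whence \<open>e0\<close> is lower semicontinuous. Whatever ultrafilters
  extend \<open>e0\<close>, they remember whether \<open>x \<in> E t\<close>, and so determine \<open>x\<close>.
\<close>

lemma embedding_into_free_ultrafilters: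
  assumes "Hausdorff_space X" "zero_dimensional_space X" "weight_le_continuum X"
    and ed: "extremally_disconnected_space X"
  obtains e where "\<And>x. x \<in> topspace X \<Longrightarrow> ultrafilter (e x)"
    "\<And>x. x \<in> topspace X \<Longrightarrow> e x \<le> cofinite"
    "\<And>P. openin X {x \<in> topspace X. eventually P (e x)}"
    "inj_on e (topspace X)"
proof -
  obtain E :: "nat set \<Rightarrow> 'a set" where E: "\<And>t. openin X (E t)" "\<And>t. closedin X (E t)"
    and sep: "\<And>x y. x \<in> topspace X \<Longrightarrow> y \<in> topspace X \<Longrightarrow> x \<noteq> y \<Longrightarrow> \<exists>t. x \<in> E t \<and> y \<notin> E t"
    by (rule clopen_separating_family[OF assms(1-3)]) (rule that)
  obtain I :: "nat set \<Rightarrow> nat set" where I: "\<And>a b. finite a \<Longrightarrow> finite b \<Longrightarrow> a \<inter> b = {} \<Longrightarrow>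
      infinite ((\<Inter>t\<in>a. I t) \<inter> (\<Inter>t\<in>b. - I t))"
    by (rule independent_family_nat) (rule that)
  define J where "J t x = {n. n \<in> I t \<longleftrightarrow> x \<in> E t}" for t x
  define e0 where "e0 x = inf cofinite (INF t. principal (J t x))" for x
  have ev: "eventually P (e0 x) \<longleftrightarrow> (\<exists>T. finite T \<and> finite ((\<Inter>t\<in>T. J t x) \<inter> {n. \<not> P n}))" for P x
  proof -
    have "eventually P (e0 x) \<longleftrightarrow> (\<exists>T. finite T \<and> eventually P (inf cofinite (INF t\<in>T. principal (J t x))))"
    proof
      assume "eventually P (e0 x)"
      then obtain Q R where "eventually Q cofinite" "eventually R (INF t. principal (J t x))"
        "\<forall>n. Q n \<and> R n \<longrightarrow> P n"
        unfolding e0_def eventually_inf by auto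
      moreover from this(2) obtain T where "finite T" "eventually R (INF t\<in>T. principal (J t x))"
        using eventually_INF[THEN iffD1] by meson
      ultimately show "\<exists>T. finite T \<and> eventually P (inf cofinite (INF t\<in>T. principal (J t x)))"
        unfolding eventually_inf by meson
    next
      assume "\<exists>T. finite T \<and> eventually P (inf cofinite (INF t\<in>T. principal (J t x)))"
      then obtain T where T: "eventually P (inf cofinite (INF t\<in>T. principal (J t x)))"
        by blast
      have "(INF t. principal (J t x)) \<le> (INF t\<in>T. principal (J t x))"
        by (rule INF_superset_mono) auto
      then have "e0 x \<le> inf cofinite (INF t\<in>T. principal (J t x))"
        unfolding e0_def by (rule inf_mono[OF order_refl])
      then show "eventually P (e0 x)"
        using T by (rule filter_leD)
    qed
    also have "\<dots> \<longleftrightarrow> (\<exists>T. finite T \<and> finite ((\<Inter>t\<in>T. J t x) \<inter> {n. \<not> P n}))"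
    proof (rule ex_cong1, rule conj_cong[OF refl])
      fix T :: "nat set set" assume "finite T"
      moreover have "{n. \<not> (n \<in> (\<Inter>t\<in>T. J t x) \<longrightarrow> P n)} = (\<Inter>t\<in>T. J t x) \<inter> {n. \<not> P n}"
        by blast
      ultimately show "eventually P (inf cofinite (INF t\<in>T. principal (J t x))) \<longleftrightarrow>
          finite ((\<Inter>t\<in>T. J t x) \<inter> {n. \<not> P n})"
        by (simp only: INF_principal_finite eventually_inf_principal eventually_cofinite)
    qed
    finally show ?thesis .
  qed
  have "lower_semicontinuous_filters X e0"
    unfolding lower_semicontinuous_filters_def
  proof (intro conjI ballI allI)
    fix x
    have "infinite (\<Inter>t\<in>T. J t x)" if "finite T" for T
    proof -
      have "(\<Inter>t\<in>T. J t x) = (\<Inter>t\<in>{t\<in>T. x \<in> E t}. I t) \<inter> (\<Inter>t\<in>{t\<in>T. x \<notin> E t}. - I t)"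
        by (auto simp: J_def)
      also have "infinite \<dots>"
        by (rule I) (use that in auto)
      finally show ?thesis .
    qed
    then show "e0 x \<noteq> bot"
      by (simp add: trivial_limit_def ev)
  next
    fix P
    show "openin X {x \<in> topspace X. eventually P (e0 x)}"
    proof (subst openin_subopen, intro ballI)
      fix x assume "x \<in> {x \<in> topspace X. eventually P (e0 x)}"
      then obtain T where x: "x \<in> topspace X" and T: "finite T" "finite ((\<Inter>t\<in>T. J t x) \<inter> {n. \<not> P n})"
        by (auto simp: ev)
      define V where "V t = (if x \<in> E t then E t else topspace X - E t)" for t
      define U where "U = topspace X \<inter> (\<Inter>t\<in>T. V t)"
      have "J t y = J t x" if "y \<in> U" "t \<in> T" for t y
        using that by (auto simp: U_def V_def J_def split: if_splits)
      then have eq: "(\<Inter>t\<in>T. J t y) = (\<Inter>t\<in>T. J t x)" if "y \<in> U" for y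
        using that by auto
      have "openin X (V t)" for t
        using E by (simp add: V_def openin_diff)
      then have "openin X U"
        unfolding U_def using T(1) openin_INT2[of T X] by (cases "T = {}") (simp_all add: openin_Int)
      moreover have "x \<in> U"
        using x by (auto simp: U_def V_def)
      moreover have "U \<subseteq> {x \<in> topspace X. eventually P (e0 x)}"
      proof
        fix y assume "y \<in> U"
        with T have "eventually P (e0 y)"
          unfolding ev using eq by metis
        with \<open>y \<in> U\<close> show "y \<in> {x \<in> topspace X. eventually P (e0 x)}"
          by (simp add: U_def)
      qed
      ultimately show "\<exists>U. openin X U \<and> x \<in> U \<and> U \<subseteq> {x \<in> topspace X. eventually P (e0 x)}"
        by blast
    qed
  qed
  then obtain e where e: "e \<le> e0" "lower_semicontinuous_filters X e"
    "\<And>x. x \<in> topspace X \<Longrightarrow> ultrafilter (e x)"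
    using extend_to_ultrafilters[OF ed] by blast
  have le: "e x \<le> inf cofinite (INF t. principal (J t x))" for x
    using e(1) by (auto simp: le_fun_def e0_def)
  have J: "eventually (\<lambda>n. n \<in> I t \<longleftrightarrow> x \<in> E t) (e x)" for t x
  proof -
    have "e x \<le> principal (J t x)"
      using le[of x] by (meson INF_lower UNIV_I inf.boundedE order_trans)
    then show ?thesis
      by (simp add: le_principal J_def)
  qed
  have "inj_on e (topspace X)"
  proof (rule inj_onI, rule ccontr)
    fix x y assume xy: "x \<in> topspace X" "y \<in> topspace X" "e x = e y" "x \<noteq> y"
    obtain t where t: "x \<in> E t" "y \<notin> E t"
      using sep xy by blast
    have "eventually (\<lambda>n. n \<in> I t) (e x)" "eventually (\<lambda>n. n \<notin> I t) (e x)"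
      using J[of t x] J[of t y] t xy(3) by auto
    then have "eventually (\<lambda>n. False) (e x)"
      by eventually_elim simp
    then show False
      using ultrafilter_neq_bot[OF e(3)[OF xy(1)]] by (simp add: trivial_limit_def)
  qed
  then show ?thesis
    using that[of e] e le by (auto simp: lower_semicontinuous_filters_def)
qed

section \<open>A permutation with a system of self-reproducing ultrafilters\<close>

text \<open>
  Two different elements of \<open>S\<close> are separated by a set \<open>A\<close>, and \<open>A\<close> or its complement belongs to
  infinitely many elements of \<open>S\<close>. Give the other part to the separated element that it contains, and
  repeat inside the part that is left.
\<close>

lemma disjoint_members:
  assumes inf: "infinite S" and ultra: "\<And>p. p \<in> S \<Longrightarrow> ultrafilter p"
  obtains u :: "nat \<Rightarrow> nat filter" and D :: "nat \<Rightarrow> nat set" where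
    "\<And>n. u n \<in> S" "\<And>n. eventually (\<lambda>k. k \<in> D n) (u n)" "disjoint_family D"
proof -
  define S' where "S' R = {p \<in> S. eventually (\<lambda>k. k \<in> R) p}" for R
  have step: "\<exists>p A. p \<in> S \<and> A \<subseteq> R \<and> eventually (\<lambda>k. k \<in> A) p \<and> infinite (S' (R - A))"
    if R: "infinite (S' R)" for R
  proof -
    have split: "S' R = S' (R \<inter> A) \<union> S' (R - A)" for A
    proof -
      have "eventually (\<lambda>k. k \<in> R \<inter> A) p \<or> eventually (\<lambda>k. k \<in> R - A) p"
        if "p \<in> S" "eventually (\<lambda>k. k \<in> R) p" for p
      proof -
        have "eventually (\<lambda>k. k \<in> A) p \<or> eventually (\<lambda>k. k \<notin> A) p"
          using ultra[OF that(1)] by (simp add: ultrafilter_iff)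
        with that(2) show ?thesis
          by (auto simp: eventually_conj_iff)
      qed
      then show ?thesis
        by (auto simp: S'_def elim: eventually_mono)
    qed
    obtain p where p: "p \<in> S' R"
      using R by fastforce
    obtain q where q: "q \<in> S' R" "p \<noteq> q"
    proof -
      have "S' R - {p} \<noteq> {}"
        using R by (metis finite.emptyI infinite_remove)
      then show ?thesis
        using that by blast
    qed
    obtain P where P: "eventually P p" "\<not> eventually P q"
      using ultrafilters_separated[of p q] p q ultra by (auto simp: S'_def)
    define A where "A = {k. P k}"
    have pA: "p \<in> S' (R \<inter> A)"
      using p P(1) by (auto simp: S'_def A_def eventually_conj)
    have qA: "q \<in> S' (R - A)"
    proof -
      have "q \<notin> S' (R \<inter> A)"
        using P(2) by (auto simp: S'_def A_def eventually_conj_iff)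
      then show ?thesis
        using q split by blast
    qed
    show ?thesis
    proof (cases "finite (S' (R - A))")
      case True
      then have "infinite (S' (R \<inter> A))"
        using R split[of A] by auto
      moreover have "R - (R - A) = R \<inter> A" by blast
      ultimately show ?thesis
        using qA by (intro exI[of _ q] exI[of _ "R - A"]) (auto simp: S'_def)
    next
      case False
      moreover have "R - (R \<inter> A) = R - A" by blast
      ultimately show ?thesis
        using pA by (intro exI[of _ p] exI[of _ "R \<inter> A"]) (auto simp: S'_def)
    qed
  qed
  \<comment> \<open>The state is the set \<open>R\<close> still available, with infinitely many elements of \<open>S\<close> living on it.\<close>
  have "\<exists>R :: nat \<Rightarrow> nat set. \<forall>n. infinite (S' (R n)) \<and> (R (Suc n) \<subseteq> R n \<and>
      (\<exists>p\<in>S. eventually (\<lambda>k. k \<in> R n - R (Suc n)) p))"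
  proof (rule dependent_nat_choice)
    have "S' UNIV = S" by (simp add: S'_def)
    with inf show "\<exists>R. infinite (S' R)" by metis
  next
    fix R and n :: nat assume "infinite (S' R)"
    from step[OF this] obtain p A where "p \<in> S" "A \<subseteq> R" "eventually (\<lambda>k. k \<in> A) p" "infinite (S' (R - A))"
      by blast
    moreover from this have "R - (R - A) = A" by blast
    ultimately show "\<exists>R'. infinite (S' R') \<and> (R' \<subseteq> R \<and> (\<exists>p\<in>S. eventually (\<lambda>k. k \<in> R - R') p))"
      by (intro exI[of _ "R - A"]) auto
  qed
  then obtain R :: "nat \<Rightarrow> nat set" where R: "\<And>n. R (Suc n) \<subseteq> R n"
      "\<And>n. \<exists>p\<in>S. eventually (\<lambda>k. k \<in> R n - R (Suc n)) p"
    by blast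
  then obtain u where u: "\<And>n. u n \<in> S" "\<And>n. eventually (\<lambda>k. k \<in> R n - R (Suc n)) (u n)"
    by metis
  have "disjoint_family (\<lambda>n. R n - R (Suc n))"
  proof -
    have "decseq R" using R(1) by (simp add: decseq_Suc_iff)
    then have "(R m - R (Suc m)) \<inter> (R n - R (Suc n)) = {}" if "m < n" for m n
      using that decseqD[of R "Suc m" n] by auto
    then show ?thesis
      unfolding disjoint_family_on_def by (metis Int_commute nat_neq_iff)
  qed
  with u show ?thesis by (rule that[of u "\<lambda>n. R n - R (Suc n)"])
qed

text \<open>
  Read \<open>m \<in> D n\<close> as: \<open>n\<close> is the parent of \<open>m\<close>. If \<open>d\<close> is the parent function, then \<open>B n\<close> can be
  taken as the set of pairs \<open>(j, k)\<close> with \<open>k \<ge> 0\<close> such that the \<open>k\<close>-th ancestor of \<open>j\<close> is \<open>n\<close>, and the permutation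
  as \<open>(j, k) \<mapsto> (j, k + 1)\<close>, which is a bijection if all integers \<open>k\<close> are admitted. Parents
  are smaller than their children, so no point of \<open>B n\<close> comes back to \<open>B n\<close>.
\<close>

lemma branching_permutation:
  fixes D :: "nat \<Rightarrow> nat set"
  assumes disj: "disjoint_family D" and above: "\<And>n. D n \<subseteq> {n<..}"
  obtains g :: "nat \<Rightarrow> nat" and B :: "nat \<Rightarrow> nat set" where
    "bij g" "disjoint_family B" "\<And>n. B n \<noteq> {}"
    "\<And>n m x. m \<in> D n \<Longrightarrow> x \<in> B m \<Longrightarrow> g x \<in> B n"
    "\<And>n x k. x \<in> B n \<Longrightarrow> 0 < k \<Longrightarrow> (g ^^ k) x \<notin> B n"
proof -
  \<comment> \<open>Indices are shifted by one, and \<open>0\<close> stands for a missing parent.\<close>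
  define d where "d i = (case i of 0 \<Rightarrow> 0 | Suc m \<Rightarrow> if \<exists>n. m \<in> D n then Suc (THE n. m \<in> D n) else 0)" for i
  have uniq: "n = n'" if "m \<in> D n" "m \<in> D n'" for m n n'
    using disj that by (auto simp: disjoint_family_on_def)
  have d_mem: "d (Suc m) = Suc n" if "m \<in> D n" for m n
  proof -
    have "(THE n. m \<in> D n) = n"
      using that uniq by blast
    with that show ?thesis by (auto simp: d_def)
  qed
  have d_le: "d i \<le> i" for i
  proof (cases i)
    case (Suc m)
    show ?thesis
    proof (cases "\<exists>n. m \<in> D n")
      case True
      then obtain n where n: "m \<in> D n" by blast
      with above[of n] d_mem[OF n] Suc show ?thesis by auto
    qed (simp add: Suc d_def)
  qed (simp add: d_def)
  have d_less: "d (Suc m) < Suc m" for m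
  proof (cases "\<exists>n. m \<in> D n")
    case True
    then obtain n where n: "m \<in> D n" by blast
    with above[of n] d_mem[OF n] show ?thesis by auto
  qed (simp add: d_def)
  have dk_le: "(d ^^ k) i \<le> i" for k i
    by (induction k) (auto intro: order_trans[OF d_le])
  have dk_less: "(d ^^ k) (Suc n) < Suc n" if k: "0 < k" for k n
  proof -
    obtain l where "k = Suc l" using gr0_implies_Suc[OF k] by blast
    then have "(d ^^ k) (Suc n) = (d ^^ l) (d (Suc n))"
      by (simp only: funpow_Suc_right o_apply)
    also have "\<dots> \<le> d (Suc n)" by (rule dk_le)
    also have "\<dots> < Suc n" by (rule d_less)
    finally show ?thesis .
  qed
  define code where "code = (\<lambda>(j :: nat, k :: int). prod_encode (j, int_encode k))"
  define decode where "decode x = (fst (prod_decode x), int_decode (snd (prod_decode x)))" for x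
  have dc [simp]: "decode (code z) = z" for z
    by (simp add: code_def decode_def split: prod.split)
  have cd [simp]: "code (decode x) = x" for x
    by (simp add: code_def decode_def)
  define g where "g x = code (fst (decode x), snd (decode x) + 1)" for x
  define B where "B n = {x. 0 \<le> snd (decode x) \<and> (d ^^ nat (snd (decode x))) (fst (decode x)) = Suc n}" for n
  have gk: "decode ((g ^^ k) x) = (fst (decode x), snd (decode x) + int k)" for k x
    by (induction k) (auto simp: g_def)
  show ?thesis
  proof
    show "bij g"
    proof (rule o_bij)
      show "(\<lambda>x. code (fst (decode x), snd (decode x) - 1)) \<circ> g = id"
        "g \<circ> (\<lambda>x. code (fst (decode x), snd (decode x) - 1)) = id"
        by (auto simp: g_def fun_eq_iff)
    qed
    show "disjoint_family B"
      by (auto simp: disjoint_family_on_def B_def)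
    show "B n \<noteq> {}" for n
    proof -
      have "code (Suc n, 0) \<in> B n" by (simp add: B_def)
      then show ?thesis by blast
    qed
    show "g x \<in> B n" if "m \<in> D n" "x \<in> B m" for n m x
    proof -
      have "nat (snd (decode x) + 1) = Suc (nat (snd (decode x)))"
        using that by (auto simp: B_def)
      with that d_mem show ?thesis
        by (auto simp: B_def g_def)
    qed
    show "(g ^^ k) x \<notin> B n" if "x \<in> B n" "0 < k" for n x k
    proof -
      have "nat (snd (decode x) + int k) = k + nat (snd (decode x))"
        using that by (auto simp: B_def)
      moreover have "(d ^^ k) (Suc n) \<noteq> Suc n"
        using dk_less[OF that(2), of n] by simp
      ultimately show ?thesis
        using that(1) by (auto simp: B_def gk funpow_add)
    qed
  qed
qed

text \<open>
  The map \<open>q \<mapsto> (n \<mapsto> g (u n-lim q))\<close> is not continuous for the product topology, so compactness gives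
  no fixed point. It is monotone on families of filters, and \<open>\<Phi> q \<le> q\<close> holds if all \<open>q n\<close> are
  principal at \<open>B n\<close>; a minimal \<open>q\<close> with \<open>\<Phi> q \<le> q\<close> satisfies \<open>\<Phi> q = q\<close>. To see that \<open>q n0\<close> is an
  ultrafilter, a set \<open>P\<close> positive for \<open>q n0\<close> has to be added to it. To keep \<open>\<Phi> q \<le> q\<close>, its preimages
  under the powers of \<open>g\<close> must be added to many \<open>q m\<close> with \<open>m\<close> a descendant of \<open>n0\<close>. The set \<open>A\<close> in the proof collects all of them: its
  points satisfy \<open>P\<close> whenever their orbit visits \<open>B n0\<close>. It is added to every \<open>q m\<close> for which it is
  positive.
\<close>

lemma self_reproducing_ultrafilters:
  fixes u :: "nat \<Rightarrow> nat filter" and g :: "nat \<Rightarrow> nat"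
  assumes u: "\<And>n. ultrafilter (u n)" and D: "\<And>n. eventually (\<lambda>m. m \<in> D n) (u n)"
    and disj: "disjoint_family B" and ne: "\<And>n. B n \<noteq> {}"
    and into: "\<And>n m x. m \<in> D n \<Longrightarrow> x \<in> B m \<Longrightarrow> g x \<in> B n"
    and no_return: "\<And>n x k. x \<in> B n \<Longrightarrow> 0 < k \<Longrightarrow> (g ^^ k) x \<notin> B n"
  obtains q where "\<And>n. ultrafilter (q n)" "\<And>n. eventually (\<lambda>x. x \<in> B n) (q n)"
    "\<And>n. q n = filtermap g (filter_lim (u n) q)"
proof -
  define \<Phi> where "\<Phi> Q n = filtermap g (filter_lim (u n) Q)" for Q n
  have ev_\<Phi>: "eventually P (\<Phi> Q n) \<longleftrightarrow> eventually (\<lambda>m. eventually (\<lambda>x. P (g x)) (Q m)) (u n)" for P Q n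
    by (simp add: \<Phi>_def eventually_filtermap eventually_filter_lim)
  have u_const: "eventually (\<lambda>m. c) (u n) \<longleftrightarrow> c" for c n
    using ultrafilter_neq_bot[OF u[of n]] by (cases c) (auto simp: trivial_limit_def)
  define \<P> where "\<P> = {Q. (\<forall>n. Q n \<noteq> bot \<and> eventually (\<lambda>x. x \<in> B n) (Q n)) \<and> \<Phi> Q \<le> Q}"
  have mono: "\<Phi> Q \<le> \<Phi> R" if "Q \<le> R" for Q R
    using that by (auto simp: le_fun_def le_filter_def ev_\<Phi> elim: eventually_mono)
  have start: "(\<lambda>n. principal (B n)) \<in> \<P>"
  proof -
    have "eventually P (\<Phi> (\<lambda>n. principal (B n)) n)" if "\<forall>x\<in>B n. P x" for P n
      unfolding ev_\<Phi> eventually_principal using D[of n]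
      by eventually_elim (use into that in blast)
    then show ?thesis
      using ne by (auto simp: \<P>_def le_fun_def le_filter_def eventually_principal principal_eq_bot_iff)
  qed
  have closed: "(\<lambda>i. INF e\<in>C. e i) \<in> \<P>"
    if C: "C \<subseteq> \<P>" "C \<noteq> {}"
      and chain: "\<And>d e. d \<in> C \<Longrightarrow> e \<in> C \<Longrightarrow> d \<le> e \<or> e \<le> d" for C
  proof -
    have ev: "eventually P (INF e\<in>C. e x) \<longleftrightarrow> (\<exists>e\<in>C. eventually P (e x))" for P x
      by (rule eventually_INF_chain[OF C(2) chain])
    have "\<Phi> (\<lambda>i. INF e\<in>C. e i) \<le> e" if "e \<in> C" for e
    proof -
      have "\<Phi> (\<lambda>i. INF e\<in>C. e i) \<le> \<Phi> e"
        using that by (intro mono) (auto simp: le_fun_def intro: INF_lower)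
      also have "\<dots> \<le> e"
        using that C by (auto simp: \<P>_def)
      finally show ?thesis .
    qed
    then have "\<Phi> (\<lambda>i. INF e\<in>C. e i) \<le> (\<lambda>i. INF e\<in>C. e i)"
      by (auto simp: le_fun_def intro: INF_greatest)
    moreover have "(INF e\<in>C. e n) \<noteq> bot" for n
      using C(1) ev[of "\<lambda>_. False" n] by (auto simp: trivial_limit_def \<P>_def)
    moreover have "eventually (\<lambda>x. x \<in> B n) (INF e\<in>C. e n)" for n
      using C ev[of "\<lambda>x. x \<in> B n" n] by (auto simp: \<P>_def)
    ultimately show ?thesis
      by (simp add: \<P>_def)
  qed
  obtain q where q: "q \<in> \<P>" "\<And>Q. Q \<in> \<P> \<Longrightarrow> Q \<le> q \<Longrightarrow> Q = q"
    using filter_family_Zorn[OF start closed] by blast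
  have q_ne: "q n \<noteq> bot" and qB: "eventually (\<lambda>x. x \<in> B n) (q n)" and \<Phi>q: "\<Phi> q \<le> q" for n
    using q(1) by (auto simp: \<P>_def)
  have "\<Phi> q \<in> \<P>"
  proof -
    have "\<Phi> q n \<noteq> bot" for n
      using q_ne by (simp add: trivial_limit_def ev_\<Phi> u_const)
    moreover have "eventually (\<lambda>x. x \<in> B n) (\<Phi> q n)" for n
      using filter_leD[OF le_funD[OF \<Phi>q]] qB by blast
    ultimately show ?thesis
      using mono[OF \<Phi>q] by (simp add: \<P>_def)
  qed
  then have fixed_point: "\<Phi> q = q"
    using q(2) \<Phi>q by blast
  have "eventually P (q n0) \<or> eventually (\<lambda>x. \<not> P x) (q n0)" for P n0
  proof (rule disjCI)
    assume pos: "\<not> eventually (\<lambda>x. \<not> P x) (q n0)"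
    define A where "A = {x. \<forall>k. (g ^^ k) x \<in> B n0 \<longrightarrow> P ((g ^^ k) x)}"
    have gA: "g x \<in> A" if "x \<in> A" for x
      unfolding A_def
    proof (intro CollectI allI impI)
      fix k assume "(g ^^ k) (g x) \<in> B n0"
      moreover have "(g ^^ k) (g x) = (g ^^ Suc k) x"
        by (simp only: funpow_Suc_right o_apply)
      moreover have "(g ^^ Suc k) x \<in> B n0 \<longrightarrow> P ((g ^^ Suc k) x)"
        using that unfolding A_def by blast
      ultimately show "P ((g ^^ k) (g x))"
        by simp
    qed
    have A_back: "x \<in> A" if "g x \<in> A" "x \<notin> B n0" for x
      unfolding A_def
    proof (intro CollectI allI impI)
      fix k assume k: "(g ^^ k) x \<in> B n0"
      with that(2) obtain l where "k = Suc l"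
        by (cases k) auto
      then have "(g ^^ k) x = (g ^^ l) (g x)"
        by (simp only: funpow_Suc_right o_apply)
      moreover have "(g ^^ l) (g x) \<in> B n0 \<longrightarrow> P ((g ^^ l) (g x))"
        using that(1) unfolding A_def by blast
      ultimately show "P ((g ^^ k) x)"
        using k by simp
    qed
    have A_n0: "x \<in> A \<longleftrightarrow> P x" if "x \<in> B n0" for x
    proof
      assume "x \<in> A" then show "P x" using that by (auto simp: A_def dest: spec[of _ 0])
    next
      assume "P x"
      show "x \<in> A" unfolding A_def
      proof (intro CollectI allI impI)
        fix k assume "(g ^^ k) x \<in> B n0"
        with no_return[OF that] have "k = 0" by blast
        with \<open>P x\<close> show "P ((g ^^ k) x)" by simp
      qed
    qed
    \<comment> \<open>\<open>A\<close> is positive for \<open>q m\<close>, so that adding \<open>A\<close> leaves a proper filter.\<close>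
    define pos' where "pos' m \<longleftrightarrow> \<not> eventually (\<lambda>x. x \<notin> A) (q m)" for m
    define Q where "Q m = (if pos' m then inf (q m) (principal A) else q m)" for m
    have Q_le: "Q \<le> q"
      by (simp add: Q_def le_fun_def)
    have "pos' n0"
    proof -
      have "eventually (\<lambda>x. \<not> P x) (q n0)" if "eventually (\<lambda>x. x \<notin> A) (q n0)"
        using that qB[of n0] by eventually_elim (use A_n0 in blast)
      with pos show ?thesis by (auto simp: pos'_def)
    qed
    \<comment> \<open>Positivity passes from \<open>q m = g (u m-lim q)\<close> to \<open>u m\<close>-many of the filters under the limit.\<close>
    have pos_lim: "eventually (\<lambda>m'. pos' m') (u m)" if "pos' m" for m
    proof (rule ccontr)
      assume "\<not> ?thesis"
      then have "eventually (\<lambda>m'. \<not> pos' m') (u m)"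
        by (simp add: ultrafilter_eventually_not[OF u])
      then have "eventually (\<lambda>m'. eventually (\<lambda>x. g x \<notin> A) (q m')) (u m)"
      proof eventually_elim
        case (elim m')
        then have not_A: "eventually (\<lambda>x. x \<notin> A) (q m')" and "m' \<noteq> n0"
          using \<open>pos' n0\<close> by (auto simp: pos'_def)
        have off: "x \<notin> B n0" if "x \<in> B m'" for x
          using that \<open>m' \<noteq> n0\<close> disj by (auto simp: disjoint_family_on_def)
        from not_A qB[of m'] show ?case
          by eventually_elim (use A_back off in blast)
      qed
      then have "eventually (\<lambda>x. x \<notin> A) (\<Phi> q m)"
        by (simp add: ev_\<Phi>)
      with that show False
        by (simp add: fixed_point pos'_def)
    qed
    have "Q \<in> \<P>"
    proof -
      have "Q n \<noteq> bot" for n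
        using q_ne[of n] by (auto simp: Q_def pos'_def trivial_limit_def eventually_inf_principal)
      moreover have "eventually (\<lambda>x. x \<in> B n) (Q n)" for n
        using filter_leD[OF le_funD[OF Q_le]] qB by blast
      moreover have "eventually R (\<Phi> Q n)" if R: "eventually R (Q n)" for R n
      proof (cases "pos' n")
        case False
        with R have "eventually R (\<Phi> q n)"
          by (simp add: Q_def fixed_point)
        then show ?thesis
          using filter_leD[OF le_funD[OF mono[OF Q_le]]] by blast
      next
        case True
        with R have "eventually (\<lambda>x. x \<in> A \<longrightarrow> R x) (\<Phi> q n)"
          by (simp add: Q_def fixed_point eventually_inf_principal)
        then show ?thesis
          unfolding ev_\<Phi> using pos_lim[OF True]
        proof eventually_elim
          case (elim m)
          then show ?case
            using gA by (auto simp: Q_def eventually_inf_principal elim: eventually_mono)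
        qed
      qed
      ultimately show ?thesis
        by (auto simp: \<P>_def le_fun_def le_filter_def)
    qed
    then have "Q = q" using q(2) Q_le by blast
    moreover have "eventually (\<lambda>x. x \<in> A) (Q n0)"
      using \<open>pos' n0\<close> by (simp add: Q_def eventually_inf_principal)
    ultimately have "eventually (\<lambda>x. x \<in> A) (q n0)" by simp
    then show "eventually P (q n0)"
      using qB[of n0] by eventually_elim (use A_n0 in blast)
  qed
  then have "ultrafilter (q n)" for n
    using q_ne by (simp add: ultrafilter_iff)
  moreover have "q n = filtermap g (filter_lim (u n) q)" for n
    using fun_cong[OF fixed_point, of n] by (simp only: \<Phi>_def)
  ultimately show ?thesis
    by (rule that[OF _ qB])
qed

section \<open>Compact families of ultrafilters as closed subspaces of \<open>\<beta>\<omega>\<close>\<close>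

lemma Hausdorff_beta_omega: "Hausdorff_space beta_omega"
  unfolding Hausdorff_space_def topspace_beta_omega
proof (intro allI impI)
  fix p q :: "nat filter"
  assume "p \<in> {p. ultrafilter p} \<and> q \<in> {p. ultrafilter p} \<and> p \<noteq> q"
  then have pq: "ultrafilter p" "ultrafilter q" "p \<noteq> q" by auto
  then obtain P where P: "eventually P p" "\<not> eventually P q"
    using ultrafilters_separated by blast
  define N where "N A = {p. ultrafilter p \<and> eventually (\<lambda>n. n \<in> A) p}" for A
  have "openin beta_omega (N A)" for A
    unfolding beta_omega_def N_def by (rule topology_generated_by_Basis) blast
  moreover have "p \<in> N {n. P n}" "q \<in> N {n. \<not> P n}"
    using pq P by (auto simp: N_def ultrafilter_eventually_not)
  moreover have "disjnt (N {n. P n}) (N {n. \<not> P n})"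
    by (auto simp: disjnt_iff N_def ultrafilter_eventually_not)
  ultimately show "\<exists>U V. openin beta_omega U \<and> openin beta_omega V \<and> p \<in> U \<and> q \<in> V \<and> disjnt U V"
    by blast
qed

text \<open>
  The supremum of filters is their intersection. An ultrafilter outside the family differs from each
  \<open>s x\<close> in some member, and by compactness one of its members belongs to no \<open>s x\<close> at all.
\<close>

lemma K_set_SUP:
  assumes comp: "compact_space X"
    and ultra: "\<And>x. x \<in> topspace X \<Longrightarrow> ultrafilter (s x)"
    and op: "\<And>P. openin X {x \<in> topspace X. eventually P (s x)}"
  shows "K_set (SUP x\<in>topspace X. s x) = s ` topspace X"
proof
  show "s ` topspace X \<subseteq> K_set (SUP x\<in>topspace X. s x)"
    using ultra by (auto simp: K_set_def topspace_beta_omega intro: SUP_upper)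
  show "K_set (SUP x\<in>topspace X. s x) \<subseteq> s ` topspace X"
  proof
    fix p assume "p \<in> K_set (SUP x\<in>topspace X. s x)"
    then have p: "ultrafilter p" "p \<le> (SUP x\<in>topspace X. s x)"
      by (auto simp: K_set_def topspace_beta_omega)
    show "p \<in> s ` topspace X"
    proof (rule ccontr)
      assume "p \<notin> s ` topspace X"
      then have "\<forall>x\<in>topspace X. \<exists>P. eventually P p \<and> \<not> eventually P (s x)"
        using ultrafilters_separated[OF p(1) ultra] by (metis imageI)
      then obtain P where P: "\<And>x. x \<in> topspace X \<Longrightarrow> eventually (P x) p"
          "\<And>x. x \<in> topspace X \<Longrightarrow> \<not> eventually (P x) (s x)"
        by metis
      define U where "U x = {y \<in> topspace X. eventually (\<lambda>n. \<not> P x n) (s y)}" for x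
      have "topspace X \<subseteq> (\<Union>x\<in>topspace X. U x)"
        using P(2) ultra by (auto simp: U_def ultrafilter_eventually_not)
      moreover have "\<forall>V\<in>U ` topspace X. openin X V"
        using op by (auto simp: U_def)
      ultimately obtain \<F> where \<F>: "finite \<F>" "\<F> \<subseteq> U ` topspace X" "topspace X \<subseteq> \<Union>\<F>"
        using comp unfolding compact_space_alt by meson
      then obtain T where T: "finite T" "T \<subseteq> topspace X" "\<F> = U ` T"
        by (meson finite_subset_image)
      have "eventually (\<lambda>n. \<not> (\<forall>x\<in>T. P x n)) (s y)" if y: "y \<in> topspace X" for y
      proof -
        obtain x where x: "x \<in> T" "y \<in> U x"
          using y \<F>(3) T(3) by auto
        then have "eventually (\<lambda>n. \<not> P x n) (s y)"
          by (simp add: U_def)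
        then show ?thesis
          by eventually_elim (use x in blast)
      qed
      then have "eventually (\<lambda>n. \<not> (\<forall>x\<in>T. P x n)) (SUP x\<in>topspace X. s x)"
        by (auto simp: eventually_Sup)
      then have "eventually (\<lambda>n. \<not> (\<forall>x\<in>T. P x n)) p"
        by (rule filter_leD[OF p(2)])
      moreover have "eventually (\<lambda>n. \<forall>x\<in>T. P x n) p"
        using T P(1) by (intro eventually_ball_finite) auto
      ultimately show False
        using ultrafilter_eventually_not[OF p(1), of "\<lambda>n. \<forall>x\<in>T. P x n"] by blast
    qed
  qed
qed

lemma K_space_SUP_homeomorphic:
  assumes comp: "compact_space X"
    and ultra: "\<And>x. x \<in> topspace X \<Longrightarrow> ultrafilter (s x)"
    and op: "\<And>P. openin X {x \<in> topspace X. eventually P (s x)}"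
    and inj: "inj_on s (topspace X)"
  shows "K_space (SUP x\<in>topspace X. s x) homeomorphic_space X"
proof -
  have "continuous_map X beta_omega s"
    unfolding beta_omega_def
  proof (rule continuous_on_generated_topo)
    fix U assume "U \<in> range (\<lambda>A. {p. ultrafilter p \<and> eventually (\<lambda>n. n \<in> A) p})"
    then obtain A where "U = {p. ultrafilter p \<and> eventually (\<lambda>n. n \<in> A) p}"
      by blast
    then have "s -` U \<inter> topspace X = {x \<in> topspace X. eventually (\<lambda>n. n \<in> A) (s x)}"
      using ultra by auto
    with op show "openin X (s -` U \<inter> topspace X)"
      by simp
  next
    show "s ` topspace X \<subseteq> \<Union>(range (\<lambda>A. {p. ultrafilter p \<and> eventually (\<lambda>n. n \<in> A) p}))"
    proof
      fix p assume "p \<in> s ` topspace X"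
      then have "p \<in> {p. ultrafilter p \<and> eventually (\<lambda>n. n \<in> UNIV) p}"
        using ultra by auto
      then show "p \<in> \<Union>(range (\<lambda>A. {p. ultrafilter p \<and> eventually (\<lambda>n. n \<in> A) p}))"
        by blast
    qed
  qed
  then have "embedding_map X beta_omega s"
    using comp Hausdorff_beta_omega inj continuous_imp_embedding_map by blast
  then have "X homeomorphic_space subtopology beta_omega (s ` topspace X)"
    by (rule embedding_map_imp_homeomorphic_space)
  moreover have "K_set (SUP x\<in>topspace X. s x) = s ` topspace X"
    by (rule K_set_SUP[OF comp ultra op])
  ultimately show ?thesis
    unfolding K_space_def by (metis homeomorphic_space_sym)
qed

section \<open>Non-reversibility\<close>

lemma not_reversible_filterI:
  assumes f: "bij f" and le: "filtermap f F \<le> F" and not_ge: "\<not> F \<le> filtermap f F"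
  shows "\<not> reversible_filter F"
proof
  assume rev: "reversible_filter F"
  define h where "h = map_option f"
  have bij: "bij h"
  proof (rule o_bij)
    show "map_option (inv f) \<circ> h = id"
      using f by (simp add: fun_eq_iff h_def option.map_comp o_def bij_is_inj option.map_ident)
    show "h \<circ> map_option (inv f) = id"
      using f by (simp add: fun_eq_iff h_def option.map_comp o_def bij_is_surj surj_f_inv_f option.map_ident)
  qed
  have "continuous_map (filter_space F) (filter_space F) h"
    unfolding continuous_map_def
  proof (intro conjI allI impI)
    fix U assume "openin (filter_space F) U"
    then have U: "None \<in> U \<Longrightarrow> eventually (\<lambda>n. Some n \<in> U) F"
      by (simp add: openin_filter_space)
    have "eventually (\<lambda>n. Some (f n) \<in> U) F" if "None \<in> U"
      using filter_leD[OF le U[OF that]] by (simp add: eventually_filtermap)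
    then show "openin (filter_space F) {x \<in> topspace (filter_space F). h x \<in> U}"
      by (simp add: openin_filter_space h_def)
  qed auto
  with rev bij have "homeomorphic_map (filter_space F) (filter_space F) h"
    by (simp add: reversible_filter_def reversible_space_def)
  then have op: "open_map (filter_space F) (filter_space F) h"
    by (rule homeomorphic_imp_open_map)
  have "F \<le> filtermap f F"
  proof (rule filter_leI)
    fix P assume "eventually P (filtermap f F)"
    then have "openin (filter_space F) (insert None (Some ` {n. P (f n)}))"
      by (simp add: openin_filter_space eventually_filtermap image_iff)
    then have "openin (filter_space F) (h ` insert None (Some ` {n. P (f n)}))"
      using op unfolding open_map_def by blast
    then have "eventually (\<lambda>n. Some n \<in> h ` insert None (Some ` {n. P (f n)})) F"
      by (simp add: openin_filter_space h_def)
    then show "eventually P F"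
      by (rule eventually_mono) (auto simp: h_def)
  qed
  with not_ge show False by contradiction
qed

text \<open>
  The copy of \<open>X\<close> consists of the ultrafilters \<open>s x = g (l x)\<close>, where \<open>l x\<close> is the limit of \<open>q\<close> along \<open>e x\<close>. The
  inverse \<open>f\<close> of \<open>g\<close> maps \<open>s x\<close> to \<open>l x\<close>, a limit of the points \<open>q m = s (z m)\<close> of the copy. The complement of
  \<open>B 0\<close> belongs to all \<open>l x\<close>, but not to \<open>q 0\<close>, so \<open>f\<close> does not map the copy onto itself.
\<close>

lemma nonreversible_copy:
  fixes e :: "'a \<Rightarrow> nat filter"
  assumes comp: "compact_space X" and inf: "infinite (topspace X)"
    and ultra: "\<And>x. x \<in> topspace X \<Longrightarrow> ultrafilter (e x)"
    and free: "\<And>x. x \<in> topspace X \<Longrightarrow> e x \<le> cofinite"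
    and op: "\<And>P. openin X {x \<in> topspace X. eventually P (e x)}"
    and inj: "inj_on e (topspace X)"
  shows "\<exists>F. F \<le> cofinite \<and> \<not> reversible_filter F \<and> K_space F homeomorphic_space X"
proof -
  have "infinite (e ` topspace X)"
    using inf inj by (simp add: finite_image_iff)
  then obtain u :: "nat \<Rightarrow> nat filter" and D0 where
    u: "\<And>n. u n \<in> e ` topspace X" "\<And>n. eventually (\<lambda>k. k \<in> D0 n) (u n)" "disjoint_family D0"
    using disjoint_members[of "e ` topspace X"] ultra by blast
  have "\<forall>n. \<exists>x. x \<in> topspace X \<and> u n = e x"
    using u(1) by blast
  then obtain z where z: "\<And>n. z n \<in> topspace X" "\<And>n. u n = e (z n)"
    by metis
  have u_ultra: "ultrafilter (u n)" and u_free: "u n \<le> cofinite" for n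
    using z ultra free by auto
  have avoid: "eventually (\<lambda>m. m \<noteq> k) (e x)" if "x \<in> topspace X" for x k
    using filter_leD[OF free[OF that]] by (simp add: eventually_cofinite)
  define D where "D n = D0 n \<inter> {n<..}" for n
  have D: "eventually (\<lambda>k. k \<in> D n) (u n)" for n
  proof -
    have "finite {k. \<not> n < k}"
      by (rule finite_subset[of _ "{..n}"]) auto
    then have "eventually (\<lambda>k. n < k) (u n)"
      using filter_leD[OF u_free] by (simp add: eventually_cofinite)
    with u(2) show ?thesis
      by (simp add: D_def eventually_conj)
  qed
  have D_disj: "disjoint_family D"
    using u(3) by (auto simp: disjoint_family_on_def D_def)
  have D_above: "D n \<subseteq> {n<..}" for n
    by (auto simp: D_def)
  obtain g :: "nat \<Rightarrow> nat" and B where g: "bij g" and B: "disjoint_family B" "\<And>n. B n \<noteq> {}"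
    "\<And>n m x. m \<in> D n \<Longrightarrow> x \<in> B m \<Longrightarrow> g x \<in> B n"
    "\<And>n x k. x \<in> B n \<Longrightarrow> 0 < k \<Longrightarrow> (g ^^ k) x \<notin> B n"
    using branching_permutation[OF D_disj D_above] by blast
  obtain q where q: "\<And>n. ultrafilter (q n)" "\<And>n. eventually (\<lambda>x. x \<in> B n) (q n)"
    "\<And>n. q n = filtermap g (filter_lim (u n) q)"
    by (rule self_reproducing_ultrafilters[of u D B g, OF u_ultra D B(1,2)]) ((rule B(3) B(4) that; assumption)+)
  have B_eq: "m = n" if "x \<in> B m" "x \<in> B n" for m n x
    using B(1) that by (auto simp: disjoint_family_on_def)
  have q_mem: "eventually (\<lambda>x. \<exists>m\<in>M. x \<in> B m) (q n) \<longleftrightarrow> n \<in> M" for M n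
  proof
    assume "eventually (\<lambda>x. \<exists>m\<in>M. x \<in> B m) (q n)"
    then have "eventually (\<lambda>x. n \<in> M) (q n)"
      using q(2)[of n] by eventually_elim (use B_eq in blast)
    then show "n \<in> M"
      using ultrafilter_neq_bot[OF q(1)] by (auto simp: trivial_limit_def)
  next
    assume "n \<in> M"
    with q(2)[of n] show "eventually (\<lambda>x. \<exists>m\<in>M. x \<in> B m) (q n)"
      by (auto elim: eventually_mono)
  qed
  define l where "l x = filter_lim (e x) q" for x
  define s where "s x = filtermap g (l x)" for x
  have s_z: "s (z n) = q n" for n
    using q(3)[of n] z(2) by (simp add: s_def l_def)
  have ev_s: "eventually P (s x) \<longleftrightarrow> eventually (\<lambda>m. eventually (\<lambda>x. P (g x)) (q m)) (e x)" for P x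
    by (simp add: s_def l_def eventually_filtermap eventually_filter_lim)
  have l_mem: "eventually (\<lambda>x. \<exists>m\<in>M. x \<in> B m) (l x) \<longleftrightarrow> eventually (\<lambda>m. m \<in> M) (e x)" for M x
    by (simp add: l_def eventually_filter_lim q_mem)
  have s_ultra: "ultrafilter (s x)" if "x \<in> topspace X" for x
    unfolding s_def l_def by (intro ultrafilter_filtermap ultrafilter_filter_lim ultra that q(1))
  have s_op: "openin X {x \<in> topspace X. eventually P (s x)}" for P
    unfolding ev_s by (rule op)
  define f where "f = inv g"
  have fg: "f (g x) = x" for x
    using g by (simp add: f_def bij_is_inj)
  have f_s: "filtermap f (s x) = l x" for x
    by (simp add: s_def filtermap_filtermap fg)
  have ev_l: "eventually P (l x) \<longleftrightarrow> eventually (\<lambda>y. P (f y)) (s x)" for P x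
    unfolding f_s[symmetric] by (rule eventually_filtermap)
  have s_inj: "inj_on s (topspace X)"
  proof (rule inj_onI, rule ccontr)
    fix x y assume xy: "x \<in> topspace X" "y \<in> topspace X" "s x = s y" "x \<noteq> y"
    then have "e x \<noteq> e y"
      using inj by (auto dest: inj_onD)
    then obtain P where P: "eventually P (e x)" "\<not> eventually P (e y)"
      using ultrafilters_separated[OF ultra ultra] xy by metis
    have "l x = l y"
      using f_s xy(3) by metis
    then show False
      using P l_mem[of "{m. P m}" x] l_mem[of "{m. P m}" y] by simp
  qed
  define F where "F = (SUP x\<in>topspace X. s x)"
  have ev_F: "eventually P F \<longleftrightarrow> (\<forall>x\<in>topspace X. eventually P (s x))" for P
    by (simp add: F_def eventually_Sup)
  have q_le: "q n \<le> F" for n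
    using z(1) s_z unfolding F_def by (metis SUP_upper)
  have "K_space F homeomorphic_space X"
    unfolding F_def by (rule K_space_SUP_homeomorphic[OF comp s_ultra s_op s_inj])
  moreover have "\<not> reversible_filter F"
  proof (rule not_reversible_filterI)
    show "bij f"
      unfolding f_def by (rule bij_imp_bij_inv[OF g])
    show "filtermap f F \<le> F"
    proof (rule filter_leI)
      fix P assume "eventually P F"
      then have "eventually P (q m)" for m
        by (rule filter_leD[OF q_le])
      then have "eventually P (l x)" for x
        unfolding l_def eventually_filter_lim by simp
      then show "eventually P (filtermap f F)"
        by (simp add: eventually_filtermap ev_F ev_l)
    qed
    show "\<not> F \<le> filtermap f F"
    proof
      assume "F \<le> filtermap f F"
      then have le: "q 0 \<le> filtermap f F"
        by (rule order_trans[OF q_le])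
      have "eventually (\<lambda>y. \<exists>m\<in>-{0}. y \<in> B m) (filtermap f (s x))" if "x \<in> topspace X" for x
        unfolding f_s l_mem using avoid[OF that, of 0] by (rule eventually_mono) simp
      then have "eventually (\<lambda>y. \<exists>m\<in>-{0}. y \<in> B m) (filtermap f F)"
        by (simp add: eventually_filtermap ev_F)
      from filter_leD[OF le this] show False
        unfolding q_mem by simp
    qed
  qed
  moreover have "F \<le> cofinite"
  proof -
    have "eventually (\<lambda>y. y \<noteq> k) (s x)" if x: "x \<in> topspace X" for k x
    proof -
      have *: "eventually (\<lambda>y. g y \<noteq> k) (q m)" if "f k \<notin> B m" for m
        using q(2)[of m] by eventually_elim (use that fg in metis)
      have "eventually (\<lambda>m. f k \<notin> B m) (e x)"
      proof (cases "\<exists>m. f k \<in> B m")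
        case True
        then obtain m0 where m0: "f k \<in> B m0" by blast
        have "f k \<notin> B m" if "m \<noteq> m0" for m
          using B_eq m0 that by blast
        then show ?thesis
          using avoid[OF x, of m0] by (auto elim: eventually_mono)
      qed auto
      then show ?thesis
        unfolding ev_s by (rule eventually_mono) (rule *)
    qed
    then have F_avoid: "eventually (\<lambda>y. y \<noteq> k) F" for k
      by (simp add: ev_F)
    show ?thesis
    proof (rule filter_leI)
      fix P :: "nat \<Rightarrow> bool" assume "eventually P cofinite"
      then have "eventually (\<lambda>y. \<forall>k\<in>{k. \<not> P k}. y \<noteq> k) F"
        by (intro eventually_ball_finite) (auto simp: eventually_cofinite F_avoid)
      then show "eventually P F"
        by (rule eventually_mono) blast
    qed
  qed
  ultimately show ?thesis by blast
qed

theorem theorem3p5: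
  fixes X :: "'a topology"
  assumes "Hausdorff_space X"
    and "compact_space X"
    and "zero_dimensional_space X"
    and "extremally_disconnected_space X"
    and "weight_le_continuum X"
    and "infinite (topspace X)"
  shows "\<exists>F :: nat filter. F \<le> cofinite \<and> \<not> reversible_filter F \<and>
           K_space F homeomorphic_space X"
proof -
  obtain e :: "'a \<Rightarrow> nat filter" where "\<And>x. x \<in> topspace X \<Longrightarrow> ultrafilter (e x)"
    "\<And>x. x \<in> topspace X \<Longrightarrow> e x \<le> cofinite"
    "\<And>P. openin X {x \<in> topspace X. eventually P (e x)}"
    "inj_on e (topspace X)"
    by (rule embedding_into_free_ultrafilters[OF assms(1,3,5,4)]) (rule that)
  then show ?thesis
    by (rule nonreversible_copy[OF assms(2,6)])
qed

end
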